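(* Let $a,b>0$ be real numbers and $0\le p\le 1$. Then $$p(1-p)\frac{(a-b)^2}{\max\{a,b\}}\le d_p(a,b)+d_{1-p}(a,b)\le p(1-p)\frac{(a-b)^2}{\min\{a,b\}}.$$
   Context: For real $a,b>0$ and $0\le p\le 1$, $d_p(a,b):=pa+(1-p)b-a^pb^{1-p}$. *)

theory Defs
  imports Complex_Main
begin

definition d :: "real \<Rightarrow> real \<Rightarrow> real \<Rightarrow> real" where
  "d p a b = p * a + (1 - p) * b - a powr p * b powr (1 - p)"

end

theory Submission
  imports Defs "HOL-Analysis.Convex"
begin

text \<open>
  The sum of the two gaps factorizes, because \<open>a\<close> and \<open>b\<close> are \<open>a\<^sup>p a\<^sup>1\<^sup>-\<^sup>p\<close> and \<open>b\<^sup>p b\<^sup>1\<^sup>-\<^sup>p\<close>: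
  \<open>d\<^sub>p(a,b) + d\<^sub>1\<^sub>-\<^sub>p(a,b) = (a\<^sup>p - b\<^sup>p) (a\<^sup>1\<^sup>-\<^sup>p - b\<^sup>1\<^sup>-\<^sup>p)\<close>.
  For \<open>b \<le> a\<close> both factors are nonnegative. The power functions with exponents \<open>p\<close> and \<open>1 - p\<close>
  are concave, so \<open>a\<^sup>p - b\<^sup>p\<close> lies between \<open>a - b\<close> times the slope at \<open>a\<close>, which is \<open>p a\<^sup>p\<^sup>-\<^sup>1\<close>, and
  \<open>a - b\<close> times the slope at \<open>b\<close>, and the other factor is bounded likewise. On multiplying these
  bounds, the slopes at a point \<open>x\<close> combine to
  \<open>p x\<^sup>p\<^sup>-\<^sup>1 (1 - p) x\<^sup>-\<^sup>p = p (1 - p) / x\<close>, which gives exactly the maximum and the minimum in the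
  denominators. The case \<open>a \<le> b\<close> follows since everything is symmetric in \<open>a\<close> and \<open>b\<close>.
\<close>

lemma d_add_d_compl_factorization:
  fixes a b p :: real
  assumes "a > 0" and "b > 0"
  shows "d p a b + d (1 - p) a b = (a powr p - b powr p) * (a powr (1 - p) - b powr (1 - p))"
proof -
  have "a powr p * a powr (1 - p) = a" "b powr p * b powr (1 - p) = b"
    using assms by (simp_all flip: powr_add)
  then show ?thesis
    by (simp add: d_def algebra_simps)
qed

text \<open>
  By concavity the graph of the power function lies below its tangent at \<open>x\<close>. This is Young's
  inequality \<open>y\<^sup>p x\<^sup>1\<^sup>-\<^sup>p \<le> p y + (1 - p) x\<close>, divided by \<open>x\<^sup>1\<^sup>-\<^sup>p\<close>. No order between \<open>x\<close> and \<open>y\<close> is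
  assumed, so that exchanging them turns the upper bound for a difference of powers into a lower
  bound.
\<close>

lemma powr_diff_le_tangent:
  fixes x y p :: real
  assumes "x > 0" and "y > 0" and "0 \<le> p" and "p \<le> 1"
  shows "y powr p - x powr p \<le> p * x powr (p - 1) * (y - x)"
proof -
  have young: "y powr p * x powr (1 - p) \<le> p * y + (1 - p) * x"
    using assms by (intro Youngs_inequality_0) auto
  have inv: "x powr (1 - p) * x powr (p - 1) = 1"
    using assms by (simp flip: powr_add)
  have "x * x powr (p - 1) = x powr p"
    using assms by (simp add: powr_mult_base)
  moreover have "y powr p * (x powr (1 - p) * x powr (p - 1)) \<le> (p * y + (1 - p) * x) * x powr (p - 1)"
    using mult_right_mono[OF young, of "x powr (p - 1)"] by (simp add: mult.assoc)
  ultimately show ?thesis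
    unfolding inv by (simp add: algebra_simps)
qed

lemma powr_slopes_mult:
  fixes x p :: real
  assumes "x > 0"
  shows "(p * x powr (p - 1) * c) * ((1 - p) * x powr (- p) * c) = p * (1 - p) * (c\<^sup>2 / x)"
proof -
  have "x powr (p - 1) * x powr (- p) = 1 / x"
    using assms by (simp add: powr_neg_one flip: powr_add)
  then have "(p * (1 - p) * c\<^sup>2) * (x powr (p - 1) * x powr (- p)) = (p * (1 - p) * c\<^sup>2) * (1 / x)"
    by (rule arg_cong)
  then show ?thesis
    by (simp add: power2_eq_square mult_ac)
qed

lemma d_add_d_compl_bounds_ordered:
  fixes a b p :: real
  assumes "0 < b" and "b \<le> a" and "0 \<le> p" and "p \<le> 1"
  shows "p * (1 - p) * ((a - b)\<^sup>2 / a) \<le> d p a b + d (1 - p) a b"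
    and "d p a b + d (1 - p) a b \<le> p * (1 - p) * ((a - b)\<^sup>2 / b)"
proof -
  have a: "a > 0" using assms by simp
  have lower: "q * a powr (q - 1) * (a - b) \<le> a powr q - b powr q"
    and upper: "a powr q - b powr q \<le> q * b powr (q - 1) * (a - b)"
    if "0 \<le> q" "q \<le> 1" for q
    using powr_diff_le_tangent[of a b q] powr_diff_le_tangent[of b a q] a assms(1) that
    by (simp_all add: algebra_simps)
  note sum = d_add_d_compl_factorization[OF a assms(1)]
  show "p * (1 - p) * ((a - b)\<^sup>2 / a) \<le> d p a b + d (1 - p) a b"
    unfolding sum powr_slopes_mult[OF a, symmetric]
    using lower[of p] lower[of "1 - p"] assms
    by (intro mult_mono') simp_all
  show "d p a b + d (1 - p) a b \<le> p * (1 - p) * ((a - b)\<^sup>2 / b)"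
    unfolding sum powr_slopes_mult[OF assms(1), symmetric]
    using upper[of p] upper[of "1 - p"] assms
    by (intro mult_mono') (simp_all add: powr_mono2)
qed

lemma d_add_d_compl_commute: "d p a b + d (1 - p) a b = d p b a + d (1 - p) b a"
  by (simp add: d_def algebra_simps)

theorem theorem2p3:
  fixes a b p :: real
  assumes "a > 0" and "b > 0" and "0 \<le> p" and "p \<le> 1"
  shows "p * (1 - p) * ((a - b)\<^sup>2 / max a b) \<le> d p a b + d (1 - p) a b
       \<and> d p a b + d (1 - p) a b \<le> p * (1 - p) * ((a - b)\<^sup>2 / min a b)"
proof (cases "b \<le> a")
  case True
  then show ?thesis
    using d_add_d_compl_bounds_ordered[of b a p] assms by (simp add: max.absorb1 min.absorb2)
next
  case False
  then show ?thesis
    using d_add_d_compl_bounds_ordered[of a b p] assms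
    by (simp add: max.absorb2 min.absorb1 d_add_d_compl_commute[of p a b] power2_commute[of a b])
qed

end
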